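(* Let $\beta\ge1$ be fixed (independent of $n$) and let $\tau>0$. For a configuration $\{x_j\}_{j=1}^n$ drawn from $\mathbf P_n^\beta$ denote by $\tilde{\mathrm s}_n=\min_{j\ne k}|x_j-x_k|$ its non-normalized spacing. Then almost surely $$\tilde{\mathrm s}_n\gtrsim n^{-\frac{\beta+2+\tau}{\beta}},$$ that is, $\liminf_{n\to\infty}n^{\frac{\beta+2+\tau}{\beta}}\,\tilde{\mathrm s}_n>0$ almost surely.
   Context: For $\beta>0$ and $n\ge1$, $\mathbf P_n^\beta$ is the probability measure on $\mathbb R^n$ with density $$p_n^\beta(x_1,\dots,x_n)=\frac1{Z_{\beta,n}}\prod_{k<j}|x_k-x_j|^\beta\, e^{-n\frac\beta2\sum_{j=1}^n\frac12x_j^2},$$ where $Z_{\beta,n}$ is the normalizing constant. "Almost surely" refers to the product measure $\mathbf P=\prod_{n=1}^\infty\mathbf P_n^{\beta}$ on sequences of configurations. *)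

theory Defs
  imports "HOL-Probability.Probability"
begin

text \<open>
  A configuration of \<open>n\<close> points is a function \<open>x :: nat \<Rightarrow> real\<close> on the index set \<open>{1..n}\<close>, and
  Lebesgue measure on \<open>\<real>\<^sup>n\<close> is the product measure \<open>\<Pi>\<^sub>M i\<in>{1..n}. lborel\<close>. This allows the
  dimension to vary along a sequence of configurations.
\<close>

definition beta_weight :: "real \<Rightarrow> nat \<Rightarrow> (nat \<Rightarrow> real) \<Rightarrow> real" where
  "beta_weight \<beta> n x =
     (\<Prod>(k, j) \<in> {(k, j). k \<in> {1..n} \<and> j \<in> {1..n} \<and> k < j}. \<bar>x k - x j\<bar> powr \<beta>) *
     exp (- (real n * (\<beta> / 2) * (\<Sum>j = 1..n. (1 / 2) * (x j)\<^sup>2)))"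

definition beta_Z :: "real \<Rightarrow> nat \<Rightarrow> real" where
  "beta_Z \<beta> n = (LINT x | (\<Pi>\<^sub>M i\<in>{1..n}. lborel). beta_weight \<beta> n x)"

definition beta_ensemble :: "real \<Rightarrow> nat \<Rightarrow> (nat \<Rightarrow> real) measure" where
  "beta_ensemble \<beta> n =
     density (\<Pi>\<^sub>M i\<in>{1..n}. lborel) (\<lambda>x. ennreal (1 / beta_Z \<beta> n * beta_weight \<beta> n x))"

text \<open>
  The spacing is only meaningful for \<open>n \<ge> 2\<close>; otherwise the minimum is over the empty set.
\<close>

definition min_spacing :: "nat \<Rightarrow> (nat \<Rightarrow> real) \<Rightarrow> real" where
  "min_spacing n x = Min {\<bar>x j - x k\<bar> | j k. j \<in> {1..n} \<and> k \<in> {1..n} \<and> j \<noteq> k}"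

end

theory Submission
  imports Defs "HOL-Complex_Analysis.Complex_Analysis"
begin

text \<open>
  Fix all points but \<open>x\<^sub>j\<close>. As a function of \<open>x\<^sub>j\<close> the density is a multiple of \<open>g\<close> to the power
  \<open>\<beta>\<close>, where \<open>g y = (\<Prod>k\<in>K. \<bar>y - x k\<bar>) * exp (- n * y\<^sup>2 / 4)\<close> with \<open>K\<close> the other indices.
  Take a real-valued function \<open>s\<close> on the unit circle (a conjugate Poisson kernel with peaks of order one
  and typical size \<open>1/n\<close>) that extends to the disc with one simple pole, at \<open>r = 1 - 1/n\<close>, and with
  the value \<open>- \<i>/n\<close> at the centre. After cancelling the poles with Blaschke factors, which cost only
  the bounded factor \<open>r ^ (n - 1)\<close>, the function \<open>g (y + s)\<close> is the modulus on the circle of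
  a holomorphic function on the disc, and its modulus at the centre is comparable to
  \<open>g\<close> evaluated at \<open>y - \<i>/n\<close>. If some other point is within \<open>\<epsilon>\<close> of \<open>y\<close>, this exceeds \<open>g y\<close> by a
  factor of at least \<open>1 / (n * \<epsilon>)\<close>. Hence \<open>g y\<close> is at most a constant times \<open>n * \<epsilon>\<close> times the average
  of \<open>g (y + s)\<close> over the circle. Raising this to the power \<open>\<beta> \<ge> 1\<close> (convexity) and integrating over
  \<open>y\<close> (translation invariance), \<open>x\<^sub>j\<close> has a neighbour within \<open>\<epsilon>\<close> with probability at most
  \<open>C * (n * \<epsilon>) powr \<beta>\<close>. A union bound over \<open>j\<close> and Borel--Cantelli conclude.
\<close>

section \<open>The mean value inequality on the unit circle\<close>

text \<open>Cauchy's integral formula at the centre exhibits \<open>F 0\<close> as the mean of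
  \<open>F\<close> over the circle, and the norm passes under the integral.\<close>

lemma norm_center_le_circle_average:
  fixes F :: "complex \<Rightarrow> complex"
  assumes cont: "continuous_on (cball 0 1) F" and hol: "F holomorphic_on ball 0 1"
  shows "norm (F 0) \<le> integral {0..1} (\<lambda>t. norm (F (cis (2 * pi * t))))"
proof -
  have ci: "((\<lambda>u. F u / (u - 0)) has_contour_integral (2 * of_real pi * \<i> * F 0)) (circlepath 0 1)"
    by (rule Cauchy_integral_circlepath[OF cont hol]) simp
  have cp: "circlepath 0 1 t = cis (2 * pi * t)" for t
    by (simp add: circlepath cis_conv_exp mult_ac)
  have "((\<lambda>t. F (cis (2 * pi * t)) / cis (2 * pi * t) * vector_derivative (circlepath 0 1) (at t within {0..1}))
      has_integral 2 * of_real pi * \<i> * F 0) {0..1}"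
    using ci unfolding has_contour_integral_def by (simp add: cp)
  \<comment> \<open>The velocity of the parametrization is \<open>2 * pi * \<i>\<close> times the
    point itself, so it cancels the Cauchy kernel and a plain average is left.\<close>
  then have "((\<lambda>t. (2 * of_real pi * \<i>) * F (cis (2 * pi * t))) has_integral 2 * of_real pi * \<i> * F 0) {0..1}"
  proof (rule has_integral_eq[rotated])
    fix t :: real assume t: "t \<in> {0..1}"
    show "F (cis (2 * pi * t)) / cis (2 * pi * t) * vector_derivative (circlepath 0 1) (at t within {0..1})
        = (2 * of_real pi * \<i>) * F (cis (2 * pi * t))"
      using t by (simp add: vector_derivative_circlepath01 cis_conv_exp mult_ac field_simps)
  qed
  from has_integral_mult_right[OF this, of "1 / (2 * of_real pi * \<i>)"]
  have hi: "((\<lambda>t. F (cis (2 * pi * t))) has_integral F 0) {0..1}"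
    by simp
  have ct: "continuous_on {0..1} (\<lambda>t. F (cis (2 * pi * t)))"
    by (rule continuous_on_compose2[OF cont]) (auto intro!: continuous_intros)
  have "norm (integral {0..1} (\<lambda>t. F (cis (2 * pi * t)))) \<le> integral {0..1} (\<lambda>t. norm (F (cis (2 * pi * t))))"
    by (rule integral_norm_bound_integral)
       (auto intro!: integrable_continuous_interval ct continuous_on_norm)
  then show ?thesis using integral_unique[OF hi] by simp
qed

section \<open>The real shift and its holomorphic counterparts on the disc\<close>

text \<open>This is the imaginary part of \<open>\<kappa> * (1 + r * z) / (1 - r * z)\<close> at
  \<open>z = cis \<theta>\<close>, the conjugate Poisson kernel scaled by \<open>\<kappa>\<close>.
  The denominator is the square of \<open>norm (1 - r * z)\<close>.\<close>

definition conj_poisson :: "real \<Rightarrow> real \<Rightarrow> real \<Rightarrow> real" where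
  "conj_poisson \<kappa> r \<theta> = 2 * \<kappa> * r * sin \<theta> / (1 - 2 * r * cos \<theta> + r\<^sup>2)"

lemma conj_poisson_denom_pos:
  fixes r \<theta> :: real
  assumes "0 < r" "r < 1"
  shows "0 < 1 - 2 * r * cos \<theta> + r\<^sup>2"
proof -
  have "0 < (1 - r)\<^sup>2" using assms by simp
  also have "\<dots> \<le> 1 - 2 * r * cos \<theta> + r\<^sup>2"
    using assms by (simp add: power2_eq_square algebra_simps)
  finally show ?thesis .
qed

lemma one_minus_mult_nz:
  assumes "0 < r" "r < 1" "norm z \<le> 1" shows "1 - of_real r * z \<noteq> (0::complex)"
proof
  assume "1 - of_real r * z = 0"
  then have "norm (of_real r * z) = 1" by simp
  moreover have "norm (of_real r * z) \<le> r" using assms by (simp add: norm_mult mult_left_le)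
  ultimately show False using assms by simp
qed

text \<open>On the circle the shift is \<open>s = - \<i> * \<kappa> * r * (z\<^sup>2 - 1) / ((1 - r
  * z) * (z - r))\<close>, which extends \<open>b + s\<close> to the disc with a simple pole at
  \<open>r\<close>. The Blaschke factor \<open>(z - r) / (1 - r * z)\<close> cancels the pole and
  yields this formula.\<close>

definition shifted_root :: "real \<Rightarrow> real \<Rightarrow> real \<Rightarrow> complex \<Rightarrow> complex" where
  "shifted_root \<kappa> r b z = of_real b * (z - of_real r) / (1 - of_real r * z)
     - \<i> * of_real (\<kappa> * r) * (z\<^sup>2 - 1) / (1 - of_real r * z)\<^sup>2"

text \<open>On the circle the conjugate of \<open>z\<close> is \<open>1 / z\<close>, so rational
  expressions in \<open>z\<close> become trigonometric: the first two identities recover the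
  denominator and the sine of \<open>conj_poisson\<close>, the third makes the Blaschke factor
  unimodular.\<close>

lemma cis_denominators:
  fixes r \<theta> :: real
  assumes "0 < r" "r < 1"
  defines "z \<equiv> cis \<theta>"
  shows "(1 - of_real r * z) * (z - of_real r) = z * of_real (1 - 2 * r * cos \<theta> + r\<^sup>2)"
    and "z\<^sup>2 - 1 = z * (2 * \<i> * of_real (sin \<theta>))"
    and "norm (z - of_real r) = norm (1 - of_real r * z)"
proof -
  have sc: "sin \<theta> * sin \<theta> = 1 - cos \<theta> * cos \<theta>" 
    using sin_cos_squared_add[of \<theta>] by (simp add: power2_eq_square)
  show "(1 - of_real r * z) * (z - of_real r) = z * of_real (1 - 2 * r * cos \<theta> + r\<^sup>2)"
    unfolding z_def complex_eq_iff by (simp add: power2_eq_square algebra_simps) (simp add: sc algebra_simps)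
  show "z\<^sup>2 - 1 = z * (2 * \<i> * of_real (sin \<theta>))"
    unfolding z_def complex_eq_iff by (simp add: power2_eq_square algebra_simps)
  have "(norm (z - of_real r))\<^sup>2 = (norm (1 - of_real r * z))\<^sup>2"
    unfolding cmod_power2 z_def by (simp add: power2_eq_square algebra_simps) (simp add: sc algebra_simps)
  then show "norm (z - of_real r) = norm (1 - of_real r * z)"
    by (simp add: power2_eq_iff_nonneg)
qed

lemma norm_shifted_root_cis:
  assumes "0 < r" "r < 1"
  shows "norm (shifted_root \<kappa> r b (cis \<theta>)) = \<bar>b + conj_poisson \<kappa> r \<theta>\<bar>"
proof -
  define z where "z = cis \<theta>"
  define D where "D = 1 - 2 * r * cos \<theta> + r\<^sup>2"
  have D: "D > 0" unfolding D_def by (rule conj_poisson_denom_pos[OF assms])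
  have nz: "1 - of_real r * z \<noteq> 0" by (rule one_minus_mult_nz[OF assms]) (simp add: z_def)
  have eq1: "(1 - of_real r * z) * (z - of_real r) = z * of_real D"
    and eq2: "z\<^sup>2 - 1 = z * (2 * \<i> * of_real (sin \<theta>))"
    and eq3: "norm (z - of_real r) = norm (1 - of_real r * z)"
    using cis_denominators[OF assms, of \<theta>] unfolding D_def z_def by simp_all
  have "\<i> * of_real (\<kappa> * r) * (z\<^sup>2 - 1) * of_real D = - (of_real (2 * \<kappa> * r * sin \<theta>) * (z * of_real D))"
    unfolding eq2 by (simp add: algebra_simps)
  also have "\<dots> = - (of_real (2 * \<kappa> * r * sin \<theta>) * ((1 - of_real r * z) * (z - of_real r)))"
    unfolding eq1 ..
  finally have *: "\<i> * of_real (\<kappa> * r) * (z\<^sup>2 - 1) * of_real D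
      = - (of_real (2 * \<kappa> * r * sin \<theta>) * ((1 - of_real r * z) * (z - of_real r)))" .
  have div: "c / P\<^sup>2 = - (S / d) * Q / P" if "c * d = - (S * (P * Q))" "P \<noteq> 0" "d \<noteq> 0" for c d S P Q :: complex
  proof -
    have "c = - (S * (P * Q)) / d" using that by (simp add: field_simps)
    then show ?thesis using that by (simp add: power2_eq_square)
  qed
  have "\<i> * of_real (\<kappa> * r) * (z\<^sup>2 - 1) / (1 - of_real r * z)\<^sup>2
      = - of_real (conj_poisson \<kappa> r \<theta>) * (z - of_real r) / (1 - of_real r * z)"
    using div[OF * nz] D unfolding conj_poisson_def D_def[symmetric] by simp
  \<comment> \<open>The real number \<open>b + s\<close> times the Blaschke factor, which has
    modulus one on the circle by \<open>eq3\<close>.\<close>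
  then have "shifted_root \<kappa> r b z = of_real (b + conj_poisson \<kappa> r \<theta>) * ((z - of_real r) / (1 - of_real r * z))"
    unfolding shifted_root_def by (simp add: algebra_simps add_divide_distrib diff_divide_distrib)
  then have "norm (shifted_root \<kappa> r b z) = \<bar>b + conj_poisson \<kappa> r \<theta>\<bar> * (norm (z - of_real r) / norm (1 - of_real r * z))"
    by (simp only: norm_mult norm_divide norm_of_real)
  then show ?thesis using nz unfolding eq3 by (simp add: z_def)
qed

text \<open>At the centre the extended shift takes the value \<open>- \<i> * \<kappa>\<close> and
  the Blaschke factor the value \<open>- r\<close>.\<close>

lemma norm_shifted_root_0:
  assumes "0 < r"
  shows "norm (shifted_root \<kappa> r b 0) = r * sqrt (b\<^sup>2 + \<kappa>\<^sup>2)"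
proof -
  have "shifted_root \<kappa> r b 0 = Complex (- (r * b)) (r * \<kappa>)"
    by (simp add: shifted_root_def complex_eq_iff)
  then have "norm (shifted_root \<kappa> r b 0) = sqrt (r\<^sup>2 * (b\<^sup>2 + \<kappa>\<^sup>2))"
    by (simp add: cmod_def power_mult_distrib algebra_simps)
  then show ?thesis using assms by (simp add: real_sqrt_mult)
qed

text \<open>A holomorphic function on the disc whose real part on the circle is \<open>(x + s)\<^sup>2\<close>:
  with \<open>A\<close> the Cayley transform, \<open>s\<close> is the imaginary part of \<open>A\<close>, and \<open>norm A\<close> squared is
  affine in the real part of \<open>A\<close> because \<open>A\<close> maps the circle to a circle.\<close>

definition shifted_square :: "real \<Rightarrow> real \<Rightarrow> real \<Rightarrow> complex \<Rightarrow> complex" where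
  "shifted_square \<kappa> r x z = (let A = of_real \<kappa> * (1 + of_real r * z) / (1 - of_real r * z) in
     of_real (x\<^sup>2) - 2 * \<i> * of_real x * A
     + (of_real (2 * \<kappa> * (1 + r\<^sup>2) / (1 - r\<^sup>2)) * A - A\<^sup>2 - of_real (\<kappa>\<^sup>2)) / 2)"

lemma Re_shifted_square_cis:
  assumes "0 < r" "r < 1"
  shows "Re (shifted_square \<kappa> r x (cis \<theta>)) = (x + conj_poisson \<kappa> r \<theta>)\<^sup>2"
proof -
  define z where "z = cis \<theta>"
  define D where "D = 1 - 2 * r * cos \<theta> + r\<^sup>2"
  define A where "A = of_real \<kappa> * (1 + of_real r * z) / (1 - of_real r * z)"
  define s where "s = conj_poisson \<kappa> r \<theta>"
  have D: "D > 0" unfolding D_def by (rule conj_poisson_denom_pos[OF assms])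
  have r1: "1 - r\<^sup>2 \<noteq> 0" using assms by (simp add: power2_eq_1_iff)
  have sc: "sin \<theta> * sin \<theta> = 1 - cos \<theta> * cos \<theta>" 
    using sin_cos_squared_add[of \<theta>] by (simp add: power2_eq_square)
  have nz: "1 - of_real r * z \<noteq> 0" by (rule one_minus_mult_nz[OF assms]) (simp add: z_def)
  have "Complex (\<kappa> * (1 - r\<^sup>2)) (2 * \<kappa> * r * sin \<theta>) * (1 - of_real r * z)
      = of_real \<kappa> * (1 + of_real r * z) * of_real D"
    unfolding complex_eq_iff z_def D_def
    by (simp add: power2_eq_square algebra_simps) (use sc in algebra)
  then have "A = Complex (\<kappa> * (1 - r\<^sup>2)) (2 * \<kappa> * r * sin \<theta>) / of_real D"
    using nz D unfolding A_def by (simp add: field_simps)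
  then have A: "A = Complex (\<kappa> * (1 - r\<^sup>2) / D) s"
    unfolding s_def conj_poisson_def D_def[symmetric] by (simp add: complex_eq_iff)
  \<comment> \<open>The Cayley transform maps the circle to a circle; this is the equation of the
    image, with denominators cleared and \<open>\<kappa>\<close> divided out.\<close>
  have D2: "D\<^sup>2 - (2 * (1 + r\<^sup>2)) * D + (1 - r\<^sup>2)\<^sup>2 + (2 * r * sin \<theta>)\<^sup>2 = 0"
    unfolding D_def by (simp add: power2_eq_square algebra_simps) (use sc in algebra)
  have circ: "(\<kappa> * (1 - r\<^sup>2) / D)\<^sup>2 + s\<^sup>2 = 2 * \<kappa> * (1 + r\<^sup>2) / (1 - r\<^sup>2) * (\<kappa> * (1 - r\<^sup>2) / D) - \<kappa>\<^sup>2"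
  proof -
    have "\<kappa>\<^sup>2 * ((1 - r\<^sup>2)\<^sup>2 + (2 * r * sin \<theta>)\<^sup>2) = \<kappa>\<^sup>2 * ((2 * (1 + r\<^sup>2)) * D - D\<^sup>2)"
      using D2 by simp
    moreover have "(\<kappa> * (1 - r\<^sup>2) / D)\<^sup>2 + s\<^sup>2 = \<kappa>\<^sup>2 * ((1 - r\<^sup>2)\<^sup>2 + (2 * r * sin \<theta>)\<^sup>2) / D\<^sup>2"
      unfolding s_def conj_poisson_def D_def[symmetric]
      by (simp add: power_divide power_mult_distrib add_divide_distrib distrib_left)
    moreover have "2 * \<kappa> * (1 + r\<^sup>2) / (1 - r\<^sup>2) * (\<kappa> * (1 - r\<^sup>2) / D) - \<kappa>\<^sup>2 = \<kappa>\<^sup>2 * ((2 * (1 + r\<^sup>2)) * D - D\<^sup>2) / D\<^sup>2"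
      using D r1 by (simp add: field_simps power2_eq_square)
    ultimately show ?thesis by simp
  qed
  have "shifted_square \<kappa> r x z = of_real (x\<^sup>2) - 2 * \<i> * of_real x * A
     + (of_real (2 * \<kappa> * (1 + r\<^sup>2) / (1 - r\<^sup>2)) * A - A\<^sup>2 - of_real (\<kappa>\<^sup>2)) / 2"
    unfolding shifted_square_def A_def Let_def ..
  then have "Re (shifted_square \<kappa> r x z) = x\<^sup>2 + 2 * x * s
     + (2 * \<kappa> * (1 + r\<^sup>2) / (1 - r\<^sup>2) * (\<kappa> * (1 - r\<^sup>2) / D) - ((\<kappa> * (1 - r\<^sup>2) / D)\<^sup>2 - s\<^sup>2) - \<kappa>\<^sup>2) / 2"
    unfolding A by (simp add: power2_eq_square)
  \<comment> \<open>By \<open>circ\<close> the affine expression in \<open>Re A\<close> equals the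
    square of \<open>norm A\<close>; subtracting the real part of \<open>A\<^sup>2\<close> leaves
    twice \<open>s\<^sup>2\<close>.\<close>
  also have "\<dots> = (x + s)\<^sup>2"
    using circ by (simp add: power2_eq_square algebra_simps)
  finally show ?thesis by (simp add: z_def s_def)
qed

text \<open>The excess over \<open>x\<^sup>2\<close> is the mean of \<open>s\<^sup>2\<close> over
  the circle. For \<open>\<kappa> = 1/n\<close> and \<open>r = 1 - 1/n\<close> it is at most
  \<open>1/n\<close>, so the Gaussian factor changes only by a bounded amount.\<close>

lemma Re_shifted_square_0:
  assumes "0 < r" "r < 1"
  shows "Re (shifted_square \<kappa> r x 0) = x\<^sup>2 + \<kappa>\<^sup>2 * (2 * r\<^sup>2 / (1 - r\<^sup>2))"
proof -
  have r1: "1 - r\<^sup>2 \<noteq> 0" using assms by (simp add: power2_eq_1_iff)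
  have "shifted_square \<kappa> r x 0
      = of_real (x\<^sup>2 + (2 * \<kappa> * (1 + r\<^sup>2) / (1 - r\<^sup>2) * \<kappa> - \<kappa>\<^sup>2 - \<kappa>\<^sup>2) / 2) - \<i> * of_real (2 * x * \<kappa>)"
    by (simp add: shifted_square_def Let_def)
  then have "Re (shifted_square \<kappa> r x 0) = x\<^sup>2 + (2 * \<kappa> * (1 + r\<^sup>2) / (1 - r\<^sup>2) * \<kappa> - \<kappa>\<^sup>2 - \<kappa>\<^sup>2) / 2"
    by simp
  also have "\<dots> = x\<^sup>2 + \<kappa>\<^sup>2 * (2 * r\<^sup>2 / (1 - r\<^sup>2))"
    using r1 by (simp add: field_simps power2_eq_square)
  finally show ?thesis .
qed

lemma holomorphic_shifted:
  assumes "0 < r" "r < 1"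
  shows "shifted_root \<kappa> r b holomorphic_on cball 0 1" "shifted_square \<kappa> r x holomorphic_on cball 0 1"
  unfolding shifted_root_def shifted_square_def Let_def
  using one_minus_mult_nz[OF assms] by (auto intro!: holomorphic_intros)

section \<open>Jensen's inequality for powers\<close>

lemma powr_ge_tangent:
  fixes u v \<beta> :: real
  assumes "\<beta> \<ge> 1" "u \<ge> 0" "v \<ge> 0"
  shows "v powr \<beta> + \<beta> * v powr (\<beta> - 1) * (u - v) \<le> u powr \<beta>"
proof (cases "u > 0 \<and> v > 0")
  case True
  have "u powr \<beta> - v powr \<beta> \<ge> \<beta> * v powr (\<beta> - 1) * (u - v)"
    using True by (intro convex_on_imp_above_tangent[OF powr_convex[OF assms(1)]])
      (auto intro!: derivative_eq_intros simp: interior_open)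
  then show ?thesis by simp
next
  \<comment> \<open>At the boundary, \<open>v = 0\<close> is trivial because
    \<open>0 powr a = 0\<close> for every \<open>a\<close>, including \<open>a = 0\<close>; for
    \<open>u = 0\<close> the claim is \<open>(1 - \<beta>) * v powr \<beta> \<le> 0\<close>.\<close>
  case False
  have "v * v powr (\<beta> - 1) = v powr \<beta>" if "v > 0"
    using that by (simp add: powr_mult_base)
  then show ?thesis
    using False assms mult_right_mono[OF assms(1), of "v powr \<beta>"] by (cases "v = 0") (auto simp: algebra_simps)
qed

text \<open>The tangent inequality at \<open>v\<close> is integrated over \<open>t\<close>. Since
  the slope is nonnegative, \<open>v\<close> may be any number below the mean of \<open>u\<close>,
  not only the mean itself.\<close>

lemma powr_le_integral_powr:
  fixes u :: "real \<Rightarrow> real"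
  assumes "\<beta> \<ge> 1" and u: "continuous_on {0..1} u" "\<And>t. u t \<ge> 0"
    and v: "0 \<le> v" "v \<le> integral {0..1} u"
  shows "v powr \<beta> \<le> integral {0..1} (\<lambda>t. u t powr \<beta>)"
proof -
  have iu: "u integrable_on {0..1}" by (rule integrable_continuous_interval[OF u(1)])
  have cp: "continuous_on {0..1} (\<lambda>t. u t powr \<beta>)"
    using assms by (intro continuous_on_powr') auto
  have "v powr \<beta> \<le> v powr \<beta> + \<beta> * v powr (\<beta> - 1) * (integral {0..1} u - v)"
    using assms by simp
  also have "\<dots> = integral {0..1} (\<lambda>t. v powr \<beta> + \<beta> * v powr (\<beta> - 1) * (u t - v))"
  proof -
    have "((\<lambda>t. v powr \<beta> + \<beta> * v powr (\<beta> - 1) * (u t - v)) has_integral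
       v powr \<beta> * 1 + \<beta> * v powr (\<beta> - 1) * (integral {0..1} u - v * 1)) {0..1}"
      using has_integral_const_real[of "v powr \<beta>" 0 1] has_integral_const_real[of v 0 1]
      by (intro has_integral_add has_integral_mult_right has_integral_diff integrable_integral[OF iu]) simp_all
    then show ?thesis by (simp add: integral_unique)
  qed
  also have "\<dots> \<le> integral {0..1} (\<lambda>t. u t powr \<beta>)"
    using u cp assms(1) v(1)
    by (intro integral_le integrable_continuous_interval powr_ge_tangent) (auto intro!: continuous_intros)
  finally show ?thesis .
qed

section \<open>The estimate in one variable\<close>

text \<open>Bounds the total cost of the \<open>n - 1\<close> Blaschke factors at the centre. It
  comes from \<open>1 / r = 1 + 1 / (n - 1) \<le> exp (1 / (n - 1))\<close> for
  \<open>r = 1 - 1/n\<close>.\<close>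

lemma exp_minus_one_le_power:
  assumes "n \<ge> 2"
  shows "exp (- 1) \<le> (1 - 1 / real n) ^ (n - 1)"
proof -
  have pos: "0 < 1 - 1 / real n" using assms by simp
  have "1 / (1 - 1 / real n) = 1 + 1 / (real n - 1)" using assms by (simp add: field_simps)
  also have "\<dots> \<le> exp (1 / (real n - 1))" by (rule exp_ge_add_one_self)
  finally have "(1 / (1 - 1 / real n)) ^ (n - 1) \<le> exp (1 / (real n - 1)) ^ (n - 1)"
    using pos by (intro power_mono) auto
  also have "\<dots> = exp 1" using assms by (simp add: exp_of_nat_mult[symmetric] of_nat_diff)
  finally have "1 \<le> exp 1 * (1 - 1 / real n) ^ (n - 1)"
    using pos by (simp add: power_one_over field_simps)
  then show ?thesis by (simp add: exp_minus field_simps)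
qed

text \<open>The function \<open>g\<close> of the overview. The exponent is free of
  \<open>\<beta>\<close>, as the power \<open>\<beta>\<close> is taken outside.\<close>

definition line_weight :: "nat \<Rightarrow> ('k \<Rightarrow> real) \<Rightarrow> 'k set \<Rightarrow> real \<Rightarrow> real" where
  "line_weight n a K y = (\<Prod>k\<in>K. \<bar>y - a k\<bar>) * exp (- (real n / 4 * y\<^sup>2))"

lemma line_weight_nonneg: "line_weight n a K y \<ge> 0"
  by (simp add: line_weight_def prod_nonneg)

lemma continuous_on_line_weight [continuous_intros]:
  "continuous_on S f \<Longrightarrow> continuous_on S (\<lambda>t. line_weight n a K (f t))"
  unfolding line_weight_def by (auto intro!: continuous_intros)

lemma continuous_on_conj_poisson:
  assumes "0 < r" "r < 1"
  shows "continuous_on UNIV (\<lambda>t. conj_poisson \<kappa> r (2 * pi * t))"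
  unfolding conj_poisson_def
  using conj_poisson_denom_pos[OF assms] by (intro continuous_intros) (metis less_irrefl)

text \<open>The average dominates \<open>norm (F 0)\<close>, where, up to bounded factors, each
  distance \<open>\<bar>y - a k\<bar>\<close> has become
  \<open>sqrt ((y - a k)\<^sup>2 + \<kappa>\<^sup>2)\<close>. For \<open>k0\<close> this is at least
  \<open>1/n\<close>, against a distance of at most \<open>\<epsilon>\<close>: hence the gain
  \<open>n * \<epsilon>\<close>.\<close>

lemma line_weight_le_average:
  fixes a :: "'k \<Rightarrow> real"
  assumes n: "n \<ge> 2" and K: "finite K" "card K + 1 = n"
    and near: "k0 \<in> K" "\<bar>y - a k0\<bar> \<le> \<epsilon>"
  defines "s \<equiv> \<lambda>t. conj_poisson (1 / real n) (1 - 1 / real n) (2 * pi * t)"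
  shows "line_weight n a K y \<le> exp (5/4) * real n * \<epsilon> * integral {0..1} (\<lambda>t. line_weight n a K (y + s t))"
proof -
  define \<kappa> r where "\<kappa> = 1 / real n" and "r = 1 - 1 / real n"
  have \<kappa>: "\<kappa> > 0" and r: "0 < r" "r < 1" using n by (auto simp: \<kappa>_def r_def)
  have s_eq: "s t = conj_poisson \<kappa> r (2 * pi * t)" for t
    by (simp only: s_def \<kappa>_def r_def)
  have \<epsilon>: "\<epsilon> \<ge> 0" using near by linarith
  define F where "F = (\<lambda>z. (\<Prod>k\<in>K. shifted_root \<kappa> r (y - a k) z) * exp (- (of_real (real n / 4) * shifted_square \<kappa> r y z)))"
  have "F holomorphic_on cball 0 1"
    unfolding F_def by (intro holomorphic_intros holomorphic_shifted r)
  then have "norm (F 0) \<le> integral {0..1} (\<lambda>t. norm (F (cis (2 * pi * t))))"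
    by (intro norm_center_le_circle_average holomorphic_on_imp_continuous_on)
       (auto intro: holomorphic_on_subset)
  \<comment> \<open>The Blaschke factors are invisible on the circle, and only the real part of the
    exponent affects the modulus.\<close>
  moreover have "norm (F (cis (2 * pi * t))) = line_weight n a K (y + s t)" for t
    by (simp add: F_def line_weight_def norm_mult prod_norm[symmetric] norm_shifted_root_cis[OF r]
        Re_shifted_square_cis[OF r] s_eq algebra_simps)
  ultimately have avg: "norm (F 0) \<le> integral {0..1} (\<lambda>t. line_weight n a K (y + s t))" by simp
  have q: "real n / 4 * (\<kappa>\<^sup>2 * (2 * r\<^sup>2 / (1 - r\<^sup>2))) \<le> 1 / 4"
  proof -
    have "1 - r\<^sup>2 = (1 + r) * \<kappa>" by (simp add: r_def \<kappa>_def power2_eq_square algebra_simps)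
    then have "real n / 4 * (\<kappa>\<^sup>2 * (2 * r\<^sup>2 / (1 - r\<^sup>2))) = 1 / 4 * (2 * r\<^sup>2 / (1 + r))"
      using n by (simp add: \<kappa>_def power2_eq_square)
    also have "r\<^sup>2 \<le> r" using r by (simp add: power2_eq_square mult_left_le)
    then have "2 * r\<^sup>2 \<le> 1 + r" using r by linarith
    then have "1 / 4 * (2 * r\<^sup>2 / (1 + r)) \<le> 1 / 4" using r by simp
    finally show ?thesis .
  qed
  \<comment> \<open>Kept free of division, so that \<open>y = a k0\<close> is covered as
    well.\<close>
  have "\<kappa> * (\<Prod>k\<in>K. \<bar>y - a k\<bar>) = (\<kappa> * \<bar>y - a k0\<bar>) * (\<Prod>k\<in>K - {k0}. \<bar>y - a k\<bar>)"
    using K near by (simp add: prod.remove)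
  also have "\<dots> \<le> (\<epsilon> * sqrt ((y - a k0)\<^sup>2 + \<kappa>\<^sup>2)) * (\<Prod>k\<in>K - {k0}. sqrt ((y - a k)\<^sup>2 + \<kappa>\<^sup>2))"
  proof (rule mult_mono)
    have "\<kappa> \<le> sqrt ((y - a k0)\<^sup>2 + \<kappa>\<^sup>2)" using \<kappa> by (intro real_le_rsqrt) auto
    then show "\<kappa> * \<bar>y - a k0\<bar> \<le> \<epsilon> * sqrt ((y - a k0)\<^sup>2 + \<kappa>\<^sup>2)"
      using near \<kappa> \<epsilon> by (subst mult.commute) (intro mult_mono, auto)
    show "(\<Prod>k\<in>K - {k0}. \<bar>y - a k\<bar>) \<le> (\<Prod>k\<in>K - {k0}. sqrt ((y - a k)\<^sup>2 + \<kappa>\<^sup>2))"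
      by (intro prod_mono) (auto intro!: real_le_rsqrt)
  qed (use \<epsilon> in \<open>auto intro!: prod_nonneg\<close>)
  also have "\<dots> = \<epsilon> * (\<Prod>k\<in>K. sqrt ((y - a k)\<^sup>2 + \<kappa>\<^sup>2))"
    using K near by (simp add: prod.remove)
  finally have roots: "(\<Prod>k\<in>K. \<bar>y - a k\<bar>) \<le> real n * \<epsilon> * (\<Prod>k\<in>K. sqrt ((y - a k)\<^sup>2 + \<kappa>\<^sup>2))"
    using n by (simp add: \<kappa>_def field_simps)
  have F0: "norm (F 0) = r ^ (n - 1) * (\<Prod>k\<in>K. sqrt ((y - a k)\<^sup>2 + \<kappa>\<^sup>2))
      * (exp (- (real n / 4 * y\<^sup>2)) * exp (- (real n / 4 * (\<kappa>\<^sup>2 * (2 * r\<^sup>2 / (1 - r\<^sup>2))))))"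
  proof -
    have "card K = n - 1" using K by simp
    then have "norm (F 0) = r ^ (n - 1) * (\<Prod>k\<in>K. sqrt ((y - a k)\<^sup>2 + \<kappa>\<^sup>2))
       * exp (- (real n / 4 * (y\<^sup>2 + \<kappa>\<^sup>2 * (2 * r\<^sup>2 / (1 - r\<^sup>2)))))"
      unfolding F_def norm_mult norm_exp_eq_Re prod_norm[symmetric] norm_shifted_root_0[OF r(1)] prod.distrib
      by (simp add: Re_shifted_square_0[OF r])
    then show ?thesis by (simp add: exp_add[symmetric] algebra_simps)
  qed
  define R where "R = (\<Prod>k\<in>K. sqrt ((y - a k)\<^sup>2 + \<kappa>\<^sup>2)) * exp (- (real n / 4 * y\<^sup>2))"
  have R: "R \<ge> 0" by (simp add: R_def prod_nonneg)
  \<comment> \<open>The constant \<open>exp (5/4)\<close> arises here: \<open>exp 1\<close> from the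
    Blaschke factors and \<open>exp (1/4)\<close> from the Gaussian bound \<open>q\<close>.\<close>
  have "exp (- 1) * exp (- (1 / 4)) * R \<le> r ^ (n - 1) * exp (- (real n / 4 * (\<kappa>\<^sup>2 * (2 * r\<^sup>2 / (1 - r\<^sup>2))))) * R"
    using exp_minus_one_le_power[OF n] q R r by (intro mult_right_mono mult_mono) (auto simp: r_def)
  also have "\<dots> = norm (F 0)" unfolding F0 R_def by (simp add: mult_ac)
  finally have "exp (- 1) * exp (- (1 / 4)) * R \<le> norm (F 0)" .
  then have RF: "R \<le> exp (5 / 4) * norm (F 0)"
    by (simp add: exp_add[symmetric] exp_minus field_simps)
  have "line_weight n a K y \<le> real n * \<epsilon> * R"
    using mult_right_mono[OF roots, of "exp (- (real n / 4 * y\<^sup>2))"] by (simp add: line_weight_def R_def mult_ac)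
  also have "\<dots> \<le> real n * \<epsilon> * (exp (5 / 4) * norm (F 0))"
    using RF \<epsilon> by (intro mult_left_mono) auto
  also have "\<dots> \<le> real n * \<epsilon> * (exp (5 / 4) * integral {0..1} (\<lambda>t. line_weight n a K (y + s t)))"
    using avg \<epsilon> by (intro mult_left_mono) auto
  finally show ?thesis by (simp add: mult_ac)
qed

lemma line_weight_powr_le_average:
  fixes a :: "'k \<Rightarrow> real"
  assumes \<beta>: "\<beta> \<ge> 1" and n: "n \<ge> 2" and K: "finite K" "card K + 1 = n"
    and \<epsilon>: "\<epsilon> > 0" and near: "\<exists>k\<in>K. \<bar>y - a k\<bar> \<le> \<epsilon>"
  defines "s \<equiv> \<lambda>t. conj_poisson (1 / real n) (1 - 1 / real n) (2 * pi * t)"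
  shows "line_weight n a K y powr \<beta>
     \<le> (exp (5/4) * real n * \<epsilon>) powr \<beta> * integral {0..1} (\<lambda>t. line_weight n a K (y + s t) powr \<beta>)"
proof -
  define C where "C = exp (5/4) * real n * \<epsilon>"
  have C: "C > 0" using n \<epsilon> by (simp add: C_def)
  from near obtain k0 where k0: "k0 \<in> K" "\<bar>y - a k0\<bar> \<le> \<epsilon>" by blast
  from line_weight_le_average[where y = y and a = a, OF n K k0]
  have le: "line_weight n a K y / C \<le> integral {0..1} (\<lambda>t. line_weight n a K (y + s t))"
    using C by (simp add: C_def s_def field_simps)
  have "continuous_on {0..1} s"
    unfolding s_def by (rule continuous_on_subset[OF continuous_on_conj_poisson]) (use n in auto)
  then have "(line_weight n a K y / C) powr \<beta> \<le> integral {0..1} (\<lambda>t. line_weight n a K (y + s t) powr \<beta>)"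
    using le C by (intro powr_le_integral_powr \<beta>)
      (auto intro!: continuous_intros simp: line_weight_nonneg)
  then show ?thesis using C unfolding C_def[symmetric]
    by (simp add: powr_divide line_weight_nonneg field_simps)
qed

text \<open>After exchanging the integrals, the shift \<open>s t\<close> does not depend on
  \<open>y\<close>, so translation invariance makes the inner integral the same for all
  \<open>t\<close>, and the parameter interval has length one.\<close>

lemma nn_integral_line_weight_near_le:
  fixes a :: "'k \<Rightarrow> real"
  assumes \<beta>: "\<beta> \<ge> 1" and n: "n \<ge> 2" and K: "finite K" "card K + 1 = n" and \<epsilon>: "\<epsilon> > 0"
  shows "(\<integral>\<^sup>+y. indicator {y. \<exists>k\<in>K. \<bar>y - a k\<bar> \<le> \<epsilon>} y * ennreal (line_weight n a K y powr \<beta>) \<partial>lborel)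
    \<le> ennreal ((exp (5/4) * real n * \<epsilon>) powr \<beta>) * (\<integral>\<^sup>+y. ennreal (line_weight n a K y powr \<beta>) \<partial>lborel)"
proof -
  define s where "s = (\<lambda>t. conj_poisson (1 / real n) (1 - 1 / real n) (2 * pi * t))"
  define f where "f = (\<lambda>y. line_weight n a K y powr \<beta>)"
  define C where "C = (exp (5/4) * real n * \<epsilon>) powr \<beta>"
  have f0: "f y \<ge> 0" for y by (simp add: f_def)
  have cs: "continuous_on UNIV s"
    unfolding s_def by (rule continuous_on_conj_poisson) (use n in auto)
  have cf: "continuous_on UNIV f"
    unfolding f_def using \<beta> by (intro continuous_on_powr' continuous_intros) (auto simp: line_weight_nonneg)
  have [measurable]: "s \<in> borel_measurable borel" "f \<in> borel_measurable borel"
    using cs cf by (auto intro: borel_measurable_continuous_onI)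
  \<comment> \<open>Rewrites the average as a nonnegative Lebesgue integral, to which Tonelli's
    theorem applies.\<close>
  have avg: "ennreal (integral {0..1} (\<lambda>t. f (y + s t))) = (\<integral>\<^sup>+t. indicator {0..1} t * ennreal (f (y + s t)) \<partial>lborel)" for y
  proof -
    have "continuous_on {0..1} (\<lambda>t. f (y + s t))"
      by (rule continuous_on_compose2[OF cf]) (auto intro!: continuous_intros continuous_on_subset[OF cs])
    then have si: "set_integrable lborel {0..1} (\<lambda>t. f (y + s t))"
      by (rule borel_integrable_atLeastAtMost')
    then have "integral {0..1} (\<lambda>t. f (y + s t)) = (LINT t|lborel. indicator {0..1} t *\<^sub>R f (y + s t))"
      by (simp add: set_borel_integral_eq_integral(2)[symmetric] set_lebesgue_integral_def)
    also have "ennreal \<dots> = (\<integral>\<^sup>+t. ennreal (indicator {0..1} t *\<^sub>R f (y + s t)) \<partial>lborel)"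
      using si unfolding set_integrable_def by (intro nn_integral_eq_integral[symmetric]) (auto simp: f0)
    also have "\<dots> = (\<integral>\<^sup>+t. indicator {0..1} t * ennreal (f (y + s t)) \<partial>lborel)"
      by (intro nn_integral_cong) (auto split: split_indicator)
    finally show ?thesis .
  qed
  have "(\<integral>\<^sup>+y. indicator {y. \<exists>k\<in>K. \<bar>y - a k\<bar> \<le> \<epsilon>} y * ennreal (f y) \<partial>lborel)
     \<le> (\<integral>\<^sup>+y. ennreal C * (\<integral>\<^sup>+t. indicator {0..1} t * ennreal (f (y + s t)) \<partial>lborel) \<partial>lborel)"
  proof (rule nn_integral_mono)
    fix y :: real
    have "f y \<le> C * integral {0..1} (\<lambda>t. f (y + s t))" if "\<exists>k\<in>K. \<bar>y - a k\<bar> \<le> \<epsilon>"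
      unfolding f_def C_def s_def by (rule line_weight_powr_le_average[OF \<beta> n K \<epsilon> that])
    then have "indicator {y. \<exists>k\<in>K. \<bar>y - a k\<bar> \<le> \<epsilon>} y * ennreal (f y) \<le> ennreal (C * integral {0..1} (\<lambda>t. f (y + s t)))"
      by (auto split: split_indicator intro!: ennreal_leI)
    also have "\<dots> = ennreal C * ennreal (integral {0..1} (\<lambda>t. f (y + s t)))"
      by (rule ennreal_mult') (simp add: C_def)
    finally show "indicator {y. \<exists>k\<in>K. \<bar>y - a k\<bar> \<le> \<epsilon>} y * ennreal (f y)
        \<le> ennreal C * (\<integral>\<^sup>+t. indicator {0..1} t * ennreal (f (y + s t)) \<partial>lborel)"
      unfolding avg .
  qed
  also have "\<dots> = ennreal C * (\<integral>\<^sup>+y. (\<integral>\<^sup>+t. indicator {0..1} t * ennreal (f (y + s t)) \<partial>lborel) \<partial>lborel)"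
    by (rule nn_integral_cmult) measurable
  also have "(\<integral>\<^sup>+y. (\<integral>\<^sup>+t. indicator {0..1} t * ennreal (f (y + s t)) \<partial>lborel) \<partial>lborel)
     = (\<integral>\<^sup>+t. (\<integral>\<^sup>+y. indicator {0..1} t * ennreal (f (y + s t)) \<partial>lborel) \<partial>lborel)"
    by (rule lborel_pair.Fubini') measurable
  also have "\<dots> = (\<integral>\<^sup>+t. indicator {0..1::real} t * (\<integral>\<^sup>+y. ennreal (f y) \<partial>lborel) \<partial>lborel)"
  proof (rule nn_integral_cong)
    fix t :: real
    have "(\<integral>\<^sup>+y. indicator {0..1} t * ennreal (f (y + s t)) \<partial>lborel) = indicator {0..1} t * (\<integral>\<^sup>+y. ennreal (f (y + s t)) \<partial>lborel)"
      by (rule nn_integral_cmult) measurable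
    also have "(\<integral>\<^sup>+y. ennreal (f (y + s t)) \<partial>lborel) = (\<integral>\<^sup>+y. ennreal (f y) \<partial>lborel)"
      using nn_integral_real_affine[of "\<lambda>y. ennreal (f y)" 1 "s t"] by (simp add: add.commute)
    finally show "(\<integral>\<^sup>+y. indicator {0..1} t * ennreal (f (y + s t)) \<partial>lborel)
       = indicator {0..1} t * (\<integral>\<^sup>+y. ennreal (f y) \<partial>lborel)" .
  qed
  also have "\<dots> = (\<integral>\<^sup>+y. ennreal (f y) \<partial>lborel)"
    by (simp add: nn_integral_multc)
  finally show ?thesis unfolding f_def C_def .
qed

section \<open>The joint density as a function of one coordinate\<close>

lemma beta_weight_nonneg: "beta_weight \<beta> n x \<ge> 0"
  by (auto simp: beta_weight_def intro!: mult_nonneg_nonneg prod_nonneg)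

lemma finite_ordered_pairs:
  "finite {(k, j). k \<in> {1..n::nat} \<and> j \<in> {1..n} \<and> k < j}"
  by (rule finite_subset[of _ "{1..n} \<times> {1..n}"]) auto

lemma measurable_beta_weight [measurable]:
  "beta_weight \<beta> n \<in> borel_measurable (\<Pi>\<^sub>M i\<in>{1..n}. lborel)"
proof -
  have "beta_weight \<beta> n = (\<lambda>x. (\<Prod>p \<in> {(k, j). k \<in> {1..n} \<and> j \<in> {1..n} \<and> k < j}. \<bar>x (fst p) - x (snd p)\<bar> powr \<beta>) *
     exp (- (real n * (\<beta> / 2) * (\<Sum>j = 1..n. (1 / 2) * (x j)\<^sup>2))))"
    by (auto simp: beta_weight_def case_prod_beta fun_eq_iff)
  moreover have "\<dots> \<in> borel_measurable (\<Pi>\<^sub>M i\<in>{1..n}. lborel)"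
  proof -
    have component: "(\<lambda>x. x i) \<in> borel_measurable (\<Pi>\<^sub>M i\<in>{Suc 0..n}. lborel :: real measure)"
      if "Suc 0 \<le> i" "i \<le> n" for i
      using measurable_component_singleton[of i "{Suc 0..n}" "\<lambda>_. lborel :: real measure"] that by simp
    show ?thesis
      by (intro borel_measurable_times borel_measurable_prod powr_real_measurable borel_measurable_abs
          borel_measurable_diff borel_measurable_const borel_measurable_exp borel_measurable_uminus
          borel_measurable_sum borel_measurable_power measurable_compose[OF _ borel_measurable_exp])
        (auto intro: component)
  qed
  ultimately show ?thesis by simp
qed

text \<open>The constant \<open>c\<close> collects the pairs avoiding \<open>j\<close> and the
  Gaussian factors of the other coordinates. It vanishes if two other points coincide, so only
  \<open>c \<ge> 0\<close> is claimed.\<close>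

lemma beta_weight_update:
  assumes j: "j \<in> {1..n}"
  shows "\<exists>c \<ge> 0. \<forall>y. beta_weight \<beta> n (x(j := y)) = c * line_weight n x ({1..n} - {j}) y powr \<beta>"
proof -
  define S where "S = {(k, l). k \<in> {1..n} \<and> l \<in> {1..n} \<and> k < l}"
  define S1 where "S1 = {(k, l). (k, l) \<in> S \<and> (k = j \<or> l = j)}"
  define K where "K = {1..n} - {j}"
  define h where "h = (\<lambda>k. (min k j, max k j))"
  define c where "c = (\<Prod>(k, l)\<in>S - S1. \<bar>x k - x l\<bar> powr \<beta>) * exp (- (real n * (\<beta> / 2) * (\<Sum>k\<in>K. (1 / 2) * (x k)\<^sup>2)))"
  have fS: "finite S" unfolding S_def by (rule finite_ordered_pairs)
  have sub: "S1 \<subseteq> S" by (auto simp: S1_def)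
  \<comment> \<open>Each \<open>k\<close> other than \<open>j\<close> contributes exactly one
    increasing pair containing \<open>j\<close>.\<close>
  have bij: "bij_betw h K S1"
    by (rule bij_betw_byWitness[where f' = "\<lambda>(k, l). if k = j then l else k"])
       (use j in \<open>auto simp: h_def K_def S1_def S_def min_def max_def\<close>)
  have "beta_weight \<beta> n (x(j := y)) = c * line_weight n x K y powr \<beta>" for y
  proof -
    define z where "z = x(j := y)"
    have "(\<Prod>(k, l)\<in>S. \<bar>z k - z l\<bar> powr \<beta>) = (\<Prod>(k, l)\<in>S - S1. \<bar>z k - z l\<bar> powr \<beta>) * (\<Prod>(k, l)\<in>S1. \<bar>z k - z l\<bar> powr \<beta>)"
      by (rule prod.subset_diff[OF sub fS])
    also have "(\<Prod>(k, l)\<in>S - S1. \<bar>z k - z l\<bar> powr \<beta>) = (\<Prod>(k, l)\<in>S - S1. \<bar>x k - x l\<bar> powr \<beta>)"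
      by (rule prod.cong) (auto simp: z_def S1_def split: if_splits)
    also have "(\<Prod>(k, l)\<in>S1. \<bar>z k - z l\<bar> powr \<beta>) = (\<Prod>k\<in>K. case h k of (k, l) \<Rightarrow> \<bar>z k - z l\<bar> powr \<beta>)"
      by (rule prod.reindex_bij_betw[OF bij, symmetric])
    also have "\<dots> = (\<Prod>k\<in>K. \<bar>y - x k\<bar> powr \<beta>)"
      by (rule prod.cong) (auto simp: h_def z_def K_def min_def max_def abs_minus_commute)
    finally have pr: "(\<Prod>(k, l)\<in>S. \<bar>z k - z l\<bar> powr \<beta>) = (\<Prod>(k, l)\<in>S - S1. \<bar>x k - x l\<bar> powr \<beta>) * (\<Prod>k\<in>K. \<bar>y - x k\<bar> powr \<beta>)" .
    have "(\<Sum>k = 1..n. (1 / 2) * (z k)\<^sup>2) = (1 / 2) * y\<^sup>2 + (\<Sum>k\<in>K. (1 / 2) * (z k)\<^sup>2)"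
      using sum.remove[of "{1..n}" j "\<lambda>k. (1 / 2) * (z k)\<^sup>2"] j by (simp add: K_def z_def)
    also have "(\<Sum>k\<in>K. (1 / 2) * (z k)\<^sup>2) = (\<Sum>k\<in>K. (1 / 2) * (x k)\<^sup>2)"
      by (rule sum.cong) (auto simp: K_def z_def)
    finally have sm: "(\<Sum>k = 1..n. (1 / 2) * (z k)\<^sup>2) = (1 / 2) * y\<^sup>2 + (\<Sum>k\<in>K. (1 / 2) * (x k)\<^sup>2)" .
    have ex: "exp (- (real n * (\<beta> / 2) * ((1 / 2) * y\<^sup>2 + T))) = exp (- (real n * (\<beta> / 2) * T)) * exp (- (real n / 4 * y\<^sup>2)) powr \<beta>" for T
      by (simp add: powr_def exp_add[symmetric] algebra_simps)
    have lw: "line_weight n x K y powr \<beta> = (\<Prod>k\<in>K. \<bar>y - x k\<bar> powr \<beta>) * exp (- (real n / 4 * y\<^sup>2)) powr \<beta>"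
      by (simp add: line_weight_def powr_mult prod_nonneg prod_powr_distrib)
    show ?thesis
      unfolding beta_weight_def S_def[symmetric] z_def[symmetric] pr sm ex lw c_def by (simp only: mult_ac)
  qed
  moreover have "c \<ge> 0" unfolding c_def by (auto intro!: mult_nonneg_nonneg prod_nonneg)
  ultimately show ?thesis unfolding K_def by blast
qed

section \<open>Normalization of the ensemble\<close>

text \<open>The polynomial factor is at most \<open>exp (m * \<bar>x\<bar>)\<close>, and completing
  the square absorbs this into half of the Gaussian exponent. What remains is a multiple of the
  normal density of variance \<open>1 / c\<close>.\<close>

lemma integrable_powr_times_gaussian:
  fixes c m :: real
  assumes "c > 0" "m \<ge> 0"
  shows "integrable lborel (\<lambda>x::real. (1 + \<bar>x\<bar>) powr m * exp (- (c * x\<^sup>2)))"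
proof (rule Bochner_Integration.integrable_bound)
  define \<sigma> where "\<sigma> = sqrt (1 / c)"
  have \<sigma>: "\<sigma> > 0" "\<sigma>\<^sup>2 = 1 / c" using assms by (auto simp: \<sigma>_def)
  show "integrable lborel (\<lambda>x::real. exp (m\<^sup>2 / (2 * c)) * sqrt (2 * pi * \<sigma>\<^sup>2) * normal_density 0 \<sigma> x)"
    using integrable_normal_density[OF \<sigma>(1)] by simp
  show "AE x in lborel. norm ((1 + \<bar>x\<bar>) powr m * exp (- (c * x\<^sup>2)))
      \<le> norm (exp (m\<^sup>2 / (2 * c)) * sqrt (2 * pi * \<sigma>\<^sup>2) * normal_density 0 \<sigma> x)"
  proof (intro AE_I2)
    fix x :: real
    have "(1 + \<bar>x\<bar>) powr m \<le> exp \<bar>x\<bar> powr m"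
      using assms by (intro powr_mono2 exp_ge_add_one_self) auto
    also have "\<dots> = exp (m * \<bar>x\<bar>)" by (simp add: powr_def mult.commute)
    finally have "(1 + \<bar>x\<bar>) powr m * exp (- (c * x\<^sup>2)) \<le> exp (m * \<bar>x\<bar>) * exp (- (c * x\<^sup>2))"
      by (rule mult_right_mono) simp
    also have "\<dots> = exp (m * \<bar>x\<bar> - c * x\<^sup>2)" by (simp add: exp_diff exp_minus field_simps)
    also have "\<dots> \<le> exp (m\<^sup>2 / (2 * c) - c * x\<^sup>2 / 2)"
    proof -
      have "0 \<le> (m - c * \<bar>x\<bar>)\<^sup>2 / (2 * c)" using assms by simp
      also have "\<dots> = m\<^sup>2 / (2 * c) - m * \<bar>x\<bar> + c * x\<^sup>2 / 2"
        using assms by (simp add: power2_diff power_mult_distrib field_simps power2_eq_square)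
      finally show ?thesis by simp
    qed
    also have "\<dots> = exp (m\<^sup>2 / (2 * c)) * exp (- (c * x\<^sup>2 / 2))" by (simp add: exp_add[symmetric])
    also have "exp (- (c * x\<^sup>2 / 2)) = sqrt (2 * pi * \<sigma>\<^sup>2) * normal_density 0 \<sigma> x"
      using \<sigma> assms unfolding normal_density_def by (simp add: mult.commute)
    finally show "norm ((1 + \<bar>x\<bar>) powr m * exp (- (c * x\<^sup>2)))
      \<le> norm (exp (m\<^sup>2 / (2 * c)) * sqrt (2 * pi * \<sigma>\<^sup>2) * normal_density 0 \<sigma> x)"
      using \<sigma> assms by (simp add: abs_mult mult.assoc)
  qed
qed measurable

text \<open>A bound in product form reduces integrability to one dimension. Each difference is at
  most \<open>(1 + \<bar>x k\<bar>) * (1 + \<bar>x l\<bar>)\<close>, hence at most the full product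
  \<open>U\<close>; the crude exponent \<open>m\<close> is \<open>\<beta>\<close> times the number
  of pairs.\<close>

lemma beta_weight_le_prod:
  assumes "\<beta> \<ge> 0"
  shows "\<exists>m \<ge> 0. \<forall>x. beta_weight \<beta> n x \<le> (\<Prod>i\<in>{1..n}. (1 + \<bar>x i\<bar>) powr m * exp (- (real n * \<beta> / 4 * (x i)\<^sup>2)))"
proof -
  define S where "S = {(k, l). k \<in> {1..n} \<and> l \<in> {1..n} \<and> k < l}"
  have fS: "finite S" unfolding S_def by (rule finite_ordered_pairs)
  have "beta_weight \<beta> n x \<le> (\<Prod>i\<in>{1..n}. (1 + \<bar>x i\<bar>) powr (\<beta> * card S) * exp (- (real n * \<beta> / 4 * (x i)\<^sup>2)))" for x
  proof -
    define U where "U = (\<Prod>i\<in>{1..n}. 1 + \<bar>x i\<bar>)"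
    have U0: "U \<ge> 0" unfolding U_def by (intro prod_nonneg) auto
    have "\<bar>x k - x l\<bar> \<le> U" if "(k, l) \<in> S" for k l
    proof -
      have "\<bar>x k - x l\<bar> \<le> (1 + \<bar>x k\<bar>) * (1 + \<bar>x l\<bar>)"
      proof -
        have "\<bar>x k - x l\<bar> \<le> \<bar>x k\<bar> + \<bar>x l\<bar>" by (rule abs_triangle_ineq4)
        also have "\<dots> \<le> \<bar>x k\<bar> + \<bar>x l\<bar> + (1 + \<bar>x k\<bar> * \<bar>x l\<bar>)" by simp
        finally show ?thesis by (simp add: algebra_simps)
      qed
      also have "\<dots> = (\<Prod>i\<in>{k, l}. 1 + \<bar>x i\<bar>)" using that by (simp add: S_def)
      also have "\<dots> \<le> U" unfolding U_def using that by (intro prod_mono2) (auto simp: S_def)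
      finally show ?thesis .
    qed
    then have "(\<Prod>(k, l)\<in>S. \<bar>x k - x l\<bar> powr \<beta>) \<le> (\<Prod>p\<in>S. U powr \<beta>)"
      using assms by (intro prod_mono) (auto intro!: powr_mono2)
    also have "\<dots> = (U powr \<beta>) ^ card S" by simp
    also have "\<dots> \<le> U powr (\<beta> * card S)"
    proof (cases "U = 0")
      case True
      then have False unfolding U_def by (auto simp: prod_zero_iff)
      then show ?thesis ..
    next
      case False
      then show ?thesis using U0 by (simp add: powr_powr[symmetric] powr_realpow)
    qed
    also have "\<dots> = (\<Prod>i\<in>{1..n}. (1 + \<bar>x i\<bar>) powr (\<beta> * card S))"
      unfolding U_def by (rule prod_powr_distrib)
    finally have "beta_weight \<beta> n x \<le> (\<Prod>i\<in>{1..n}. (1 + \<bar>x i\<bar>) powr (\<beta> * card S)) *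
        exp (- (real n * (\<beta> / 2) * (\<Sum>j = 1..n. (1 / 2) * (x j)\<^sup>2)))"
      unfolding beta_weight_def S_def[symmetric] by (intro mult_right_mono) auto
    also have "exp (- (real n * (\<beta> / 2) * (\<Sum>j = 1..n. (1 / 2) * (x j)\<^sup>2))) = (\<Prod>i\<in>{1..n}. exp (- (real n * \<beta> / 4 * (x i)\<^sup>2)))"
      by (simp add: exp_sum[symmetric] sum_negf sum_distrib_left algebra_simps)
    finally show ?thesis by (simp add: prod.distrib)
  qed
  then show ?thesis using assms by (intro exI[of _ "\<beta> * card S"]) auto
qed

lemma product_sigma_finite_lborel: "product_sigma_finite (\<lambda>_. lborel :: real measure)"
  by standard

lemma integrable_beta_weight:
  assumes "\<beta> > 0"
  shows "integrable (\<Pi>\<^sub>M i\<in>{1..n}. lborel) (beta_weight \<beta> n)"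
proof -
  interpret product_sigma_finite "\<lambda>_. lborel :: real measure" by (rule product_sigma_finite_lborel)
  obtain m where m: "m \<ge> 0" and
    le: "\<And>x. beta_weight \<beta> n x \<le> (\<Prod>i\<in>{1..n}. (1 + \<bar>x i\<bar>) powr m * exp (- (real n * \<beta> / 4 * (x i)\<^sup>2)))"
    using beta_weight_le_prod[of \<beta> n] assms by auto
  show ?thesis
  proof (rule Bochner_Integration.integrable_bound)
    show "integrable (\<Pi>\<^sub>M i\<in>{1..n}. lborel) (\<lambda>x. \<Prod>i\<in>{1..n}. (1 + \<bar>x i\<bar>) powr m * exp (- (real n * \<beta> / 4 * (x i)\<^sup>2)))"
      using assms m by (intro product_integrable_prod integrable_powr_times_gaussian) auto
    show "AE x in (\<Pi>\<^sub>M i\<in>{1..n}. lborel). norm (beta_weight \<beta> n x)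
      \<le> norm (\<Prod>i\<in>{1..n}. (1 + \<bar>x i\<bar>) powr m * exp (- (real n * \<beta> / 4 * (x i)\<^sup>2)))"
      using le order_trans[OF le abs_ge_self] by (intro AE_I2) (simp add: beta_weight_nonneg)
  qed measurable
qed

text \<open>The box \<open>B\<close> has disjoint sides of length \<open>1/2\<close>, so its points
  have distinct coordinates and the weight is positive on a set of positive volume.\<close>

lemma beta_Z_pos:
  assumes "\<beta> > 0"
  shows "beta_Z \<beta> n > 0"
proof -
  interpret product_sigma_finite "\<lambda>_. lborel :: real measure" by (rule product_sigma_finite_lborel)
  let ?P = "\<Pi>\<^sub>M i\<in>{1..n}. lborel :: real measure"
  define B where "B = (\<Pi>\<^sub>E i\<in>{1..n}. {real i .. real i + 1/2})"
  have "beta_Z \<beta> n \<noteq> 0"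
  proof
    assume "beta_Z \<beta> n = 0"
    then have "AE x in ?P. beta_weight \<beta> n x = 0"
      unfolding beta_Z_def using integral_nonneg_eq_0_iff_AE[OF integrable_beta_weight[OF assms]]
      by (simp add: beta_weight_nonneg)
    moreover have "beta_weight \<beta> n x > 0" if "x \<in> B" for x
    proof -
      have "x k \<noteq> x l" if "k \<in> {1..n}" "l \<in> {1..n}" "k < l" for k l
      proof -
        have "x k \<le> real k + 1/2" "real l \<le> x l" using \<open>x \<in> B\<close> that by (auto simp: B_def PiE_iff)
        moreover have "real k + 1 \<le> real l" using that by simp
        ultimately show ?thesis by linarith
      qed
      then show ?thesis unfolding beta_weight_def by (intro mult_pos_pos prod_pos) auto
    qed
    ultimately have "AE x in ?P. x \<notin> B"
      by (elim AE_mp) (intro AE_I2 impI, force)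
    moreover have "B \<in> sets ?P" unfolding B_def by (rule sets_PiM_I_finite) auto
    ultimately have "emeasure ?P B = 0" by (subst (asm) AE_iff_measurable[where N = B]) (auto dest: sets.sets_into_space)
    moreover have "emeasure ?P B = (\<Prod>i\<in>{1..n}. ennreal (1/2))"
      unfolding B_def by (subst emeasure_PiM) auto
    ultimately show False by (simp add: prod_zero_iff)
  qed
  moreover have "beta_Z \<beta> n \<ge> 0" unfolding beta_Z_def by (simp add: beta_weight_nonneg)
  ultimately show ?thesis by simp
qed

lemma nn_integral_beta_weight:
  assumes "\<beta> > 0"
  shows "(\<integral>\<^sup>+x. ennreal (beta_weight \<beta> n x) \<partial>(\<Pi>\<^sub>M i\<in>{1..n}. lborel)) = ennreal (beta_Z \<beta> n)"
  unfolding beta_Z_def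
  by (rule nn_integral_eq_integral[OF integrable_beta_weight[OF assms]]) (simp add: beta_weight_nonneg)

lemma emeasure_beta_ensemble:
  assumes "\<beta> > 0" and A: "A \<in> sets (\<Pi>\<^sub>M i\<in>{1..n}. lborel :: real measure)"
  shows "emeasure (beta_ensemble \<beta> n) A
    = ennreal (1 / beta_Z \<beta> n) * (\<integral>\<^sup>+x. indicator A x * ennreal (beta_weight \<beta> n x) \<partial>(\<Pi>\<^sub>M i\<in>{1..n}. lborel))"
proof -
  have [measurable]: "indicator A \<in> borel_measurable (\<Pi>\<^sub>M i\<in>{1..n}. lborel :: real measure)"
    using A by (rule borel_measurable_indicator)
  have "emeasure (beta_ensemble \<beta> n) A
    = (\<integral>\<^sup>+x. ennreal (1 / beta_Z \<beta> n * beta_weight \<beta> n x) * indicator A x \<partial>(\<Pi>\<^sub>M i\<in>{1..n}. lborel))"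
    unfolding beta_ensemble_def by (intro emeasure_density A) measurable
  also have "\<dots> = (\<integral>\<^sup>+x. ennreal (1 / beta_Z \<beta> n) * (indicator A x * ennreal (beta_weight \<beta> n x)) \<partial>(\<Pi>\<^sub>M i\<in>{1..n}. lborel))"
    using beta_Z_pos[OF assms(1), of n]
    by (intro nn_integral_cong)
       (auto simp: ennreal_mult[symmetric] beta_weight_nonneg split: split_indicator)
  also have "\<dots> = ennreal (1 / beta_Z \<beta> n) * (\<integral>\<^sup>+x. indicator A x * ennreal (beta_weight \<beta> n x) \<partial>(\<Pi>\<^sub>M i\<in>{1..n}. lborel))"
    by (intro nn_integral_cmult) measurable
  finally show ?thesis .
qed

lemma prob_space_beta_ensemble:
  assumes "\<beta> > 0"
  shows "prob_space (beta_ensemble \<beta> n)"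
proof
  let ?P = "\<Pi>\<^sub>M i\<in>{1..n}. lborel :: real measure"
  have sp: "space (beta_ensemble \<beta> n) = space ?P" by (simp add: beta_ensemble_def)
  have "(\<integral>\<^sup>+x. indicator (space ?P) x * ennreal (beta_weight \<beta> n x) \<partial>?P) = ennreal (beta_Z \<beta> n)"
    unfolding nn_integral_beta_weight[OF assms, symmetric] by (rule nn_integral_cong) simp
  then show "emeasure (beta_ensemble \<beta> n) (space (beta_ensemble \<beta> n)) = 1"
    unfolding sp using beta_Z_pos[OF assms, of n] 
    by (simp add: emeasure_beta_ensemble[OF assms] ennreal_mult'[symmetric])
qed

section \<open>The probability of a close pair\<close>

lemma emeasure_near_index_le:
  assumes \<beta>: "\<beta> \<ge> 1" and n: "n \<ge> 2" and \<epsilon>: "\<epsilon> > 0" and j: "j \<in> {1..n}"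
  shows "{x \<in> space (\<Pi>\<^sub>M i\<in>{1..n}. lborel). \<exists>k\<in>{1..n} - {j}. \<bar>x j - x k\<bar> \<le> \<epsilon>} \<in> sets (\<Pi>\<^sub>M i\<in>{1..n}. lborel)"
      (is "?N \<in> _")
    and "emeasure (beta_ensemble \<beta> n) {x \<in> space (\<Pi>\<^sub>M i\<in>{1..n}. lborel). \<exists>k\<in>{1..n} - {j}. \<bar>x j - x k\<bar> \<le> \<epsilon>}
      \<le> ennreal ((exp (5/4) * real n * \<epsilon>) powr \<beta>)"
proof -
  interpret product_sigma_finite "\<lambda>_. lborel :: real measure" by (rule product_sigma_finite_lborel)
  let ?P = "\<Pi>\<^sub>M i\<in>{1..n}. lborel :: real measure"
  let ?C = "(exp (5/4) * real n * \<epsilon>) powr \<beta>"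
  define I where "I = {1..n} - {j}"
  have I: "finite I" "j \<notin> I" "insert j I = {1..n}" "card I + 1 = n"
    using j n by (auto simp: I_def)
  have component: "(\<lambda>x. x i) \<in> borel_measurable ?P" if "i \<in> {1..n}" for i
    using measurable_component_singleton[OF that, of "\<lambda>_. lborel :: real measure"] by simp
  have "{x \<in> space ?P. \<bar>x j - x k\<bar> \<le> \<epsilon>} \<in> sets ?P" if "k \<in> I" for k
    using that j by (intro borel_measurable_le borel_measurable_abs borel_measurable_diff component
        borel_measurable_const) (auto simp: I_def)
  then have "(\<Union>k\<in>I. {x \<in> space ?P. \<bar>x j - x k\<bar> \<le> \<epsilon>}) \<in> sets ?P"
    using I by (intro sets.finite_UN) auto
  also have "(\<Union>k\<in>I. {x \<in> space ?P. \<bar>x j - x k\<bar> \<le> \<epsilon>}) = ?N" by (auto simp: I_def)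
  finally show N: "?N \<in> sets ?P" .
  have bw: "(\<lambda>x. ennreal (beta_weight \<beta> n x)) \<in> borel_measurable ?P" by measurable
  then have bN: "(\<lambda>x. indicator ?N x * ennreal (beta_weight \<beta> n x)) \<in> borel_measurable ?P"
    using borel_measurable_indicator[OF N] by (intro borel_measurable_times_ennreal)
  have "(\<integral>\<^sup>+x. indicator ?N x * ennreal (beta_weight \<beta> n x) \<partial>?P)
     = (\<integral>\<^sup>+x. \<integral>\<^sup>+y. indicator ?N (x(j := y)) * ennreal (beta_weight \<beta> n (x(j := y))) \<partial>lborel \<partial>(\<Pi>\<^sub>M i\<in>I. lborel))"
    by (rule product_nn_integral_insert[OF I(1,2), unfolded I(3), OF bN])
  also have "\<dots> \<le> (\<integral>\<^sup>+x. \<integral>\<^sup>+y. ennreal ?C * ennreal (beta_weight \<beta> n (x(j := y))) \<partial>lborel \<partial>(\<Pi>\<^sub>M i\<in>I. lborel))"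
  proof (rule nn_integral_mono)
    fix x :: "nat \<Rightarrow> real" assume x: "x \<in> space (\<Pi>\<^sub>M i\<in>I. lborel)"
    obtain c where c: "c \<ge> 0" "\<And>y. beta_weight \<beta> n (x(j := y)) = c * line_weight n x I y powr \<beta>"
      using beta_weight_update[OF j, of \<beta> x] unfolding I_def by blast
    have mem: "x(j := y) \<in> ?N \<longleftrightarrow> (\<exists>k\<in>I. \<bar>y - x k\<bar> \<le> \<epsilon>)" for y
    proof -
      have "x(j := y) \<in> space ?P"
        using x I(2,3) by (auto simp: space_PiM PiE_def extensional_def)
      then show ?thesis by (auto simp: I_def)
    qed
    have "continuous_on UNIV (\<lambda>y. line_weight n x I y powr \<beta>)"
      using \<beta> by (intro continuous_on_powr' continuous_intros) (auto simp: line_weight_nonneg)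
    then have [measurable]: "(\<lambda>y. line_weight n x I y powr \<beta>) \<in> borel_measurable borel"
      by (rule borel_measurable_continuous_onI)
    have [measurable]: "{y. \<exists>k\<in>I. \<bar>y - x k\<bar> \<le> \<epsilon>} \<in> sets borel"
    proof -
      have "{y. \<exists>k\<in>I. \<bar>y - x k\<bar> \<le> \<epsilon>} = (\<Union>k\<in>I. cball (x k) \<epsilon>)"
        by (auto simp: dist_real_def abs_minus_commute)
      then show ?thesis using I(1) by (auto intro!: borel_closed)
    qed
    have "(\<integral>\<^sup>+y. indicator ?N (x(j := y)) * ennreal (beta_weight \<beta> n (x(j := y))) \<partial>lborel)
       = (\<integral>\<^sup>+y. ennreal c * (indicator {y. \<exists>k\<in>I. \<bar>y - x k\<bar> \<le> \<epsilon>} y * ennreal (line_weight n x I y powr \<beta>)) \<partial>lborel)"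
    proof (rule nn_integral_cong)
      fix y :: real
      have "indicator ?N (x(j := y)) = (indicator {y. \<exists>k\<in>I. \<bar>y - x k\<bar> \<le> \<epsilon>} y :: ennreal)"
        unfolding indicator_def mem by simp
      moreover have "ennreal (beta_weight \<beta> n (x(j := y))) = ennreal c * ennreal (line_weight n x I y powr \<beta>)"
        unfolding c(2) using c(1) by (simp add: ennreal_mult)
      ultimately show "indicator ?N (x(j := y)) * ennreal (beta_weight \<beta> n (x(j := y)))
          = ennreal c * (indicator {y. \<exists>k\<in>I. \<bar>y - x k\<bar> \<le> \<epsilon>} y * ennreal (line_weight n x I y powr \<beta>))"
        by (simp only: mult_ac)
    qed
    also have "\<dots> = ennreal c * (\<integral>\<^sup>+y. indicator {y. \<exists>k\<in>I. \<bar>y - x k\<bar> \<le> \<epsilon>} y * ennreal (line_weight n x I y powr \<beta>) \<partial>lborel)"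
      by (intro nn_integral_cmult) measurable
    also have "\<dots> \<le> ennreal c * (ennreal ?C * (\<integral>\<^sup>+y. ennreal (line_weight n x I y powr \<beta>) \<partial>lborel))"
      by (intro mult_left_mono nn_integral_line_weight_near_le[OF \<beta> n I(1,4) \<epsilon>]) simp
    also have "\<dots> = ennreal c * ennreal ?C * (\<integral>\<^sup>+y. ennreal (line_weight n x I y powr \<beta>) \<partial>lborel)"
      by (simp only: mult.assoc)
    also have "\<dots> = (\<integral>\<^sup>+y. ennreal c * ennreal ?C * ennreal (line_weight n x I y powr \<beta>) \<partial>lborel)"
      by (intro nn_integral_cmult[symmetric]) measurable
    also have "\<dots> = (\<integral>\<^sup>+y. ennreal ?C * ennreal (beta_weight \<beta> n (x(j := y))) \<partial>lborel)"
      unfolding c(2) using c(1) by (intro nn_integral_cong) (simp add: ennreal_mult mult_ac)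
    finally show "(\<integral>\<^sup>+y. indicator ?N (x(j := y)) * ennreal (beta_weight \<beta> n (x(j := y))) \<partial>lborel)
       \<le> (\<integral>\<^sup>+y. ennreal ?C * ennreal (beta_weight \<beta> n (x(j := y))) \<partial>lborel)" .
  qed
  also have "\<dots> = (\<integral>\<^sup>+x. ennreal ?C * ennreal (beta_weight \<beta> n x) \<partial>?P)"
    by (rule product_nn_integral_insert[OF I(1,2), unfolded I(3), symmetric,
          OF borel_measurable_times_ennreal[OF borel_measurable_const bw]])
  also have "\<dots> = ennreal ?C * ennreal (beta_Z \<beta> n)"
    unfolding nn_integral_cmult[OF bw] using \<beta> by (subst nn_integral_beta_weight) simp_all
  finally have le: "(\<integral>\<^sup>+x. indicator ?N x * ennreal (beta_weight \<beta> n x) \<partial>?P) \<le> ennreal ?C * ennreal (beta_Z \<beta> n)" .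
  have Z: "beta_Z \<beta> n > 0" using \<beta> by (intro beta_Z_pos) simp
  have "emeasure (beta_ensemble \<beta> n) ?N \<le> ennreal (1 / beta_Z \<beta> n) * (ennreal ?C * ennreal (beta_Z \<beta> n))"
    using \<beta> le by (subst emeasure_beta_ensemble[OF _ N]) (auto intro!: mult_left_mono)
  also have "\<dots> = ennreal ?C" using Z by (simp add: ennreal_mult'[symmetric] ennreal_mult[symmetric])
  finally show "emeasure (beta_ensemble \<beta> n) ?N \<le> ennreal ?C" .
qed

lemma emeasure_close_pair_le:
  assumes \<beta>: "\<beta> \<ge> 1" and n: "n \<ge> 2" and \<epsilon>: "\<epsilon> > 0"
  defines "B \<equiv> {x \<in> space (\<Pi>\<^sub>M i\<in>{1..n}. lborel). \<exists>j\<in>{1..n}. \<exists>k\<in>{1..n} - {j}. \<bar>x j - x k\<bar> \<le> \<epsilon>}"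
  shows "B \<in> sets (beta_ensemble \<beta> n)"
    and "emeasure (beta_ensemble \<beta> n) B \<le> ennreal (real n * (exp (5/4) * real n * \<epsilon>) powr \<beta>)"
proof -
  define N where "N = (\<lambda>j. {x \<in> space (\<Pi>\<^sub>M i\<in>{1..n}. lborel :: real measure). \<exists>k\<in>{1..n} - {j}. \<bar>x j - x k\<bar> \<le> \<epsilon>})"
  have B: "B = (\<Union>j\<in>{1..n}. N j)" by (auto simp: B_def N_def)
  have s: "N ` {1..n} \<subseteq> sets (beta_ensemble \<beta> n)"
    using emeasure_near_index_le(1)[OF \<beta> n \<epsilon>] by (auto simp: N_def beta_ensemble_def)
  then show "B \<in> sets (beta_ensemble \<beta> n)" unfolding B by (intro sets.finite_UN) auto
  have "emeasure (beta_ensemble \<beta> n) B \<le> (\<Sum>j\<in>{1..n}. emeasure (beta_ensemble \<beta> n) (N j))"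
    unfolding B by (rule emeasure_subadditive_finite[OF _ s]) simp
  also have "\<dots> \<le> (\<Sum>j\<in>{1..n}. ennreal ((exp (5/4) * real n * \<epsilon>) powr \<beta>))"
    unfolding N_def by (intro sum_mono emeasure_near_index_le(2)[OF \<beta> n \<epsilon>])
  also have "\<dots> = ennreal (real n * (exp (5/4) * real n * \<epsilon>) powr \<beta>)"
    by (simp add: ennreal_mult ennreal_of_nat_eq_real_of_nat)
  finally show "emeasure (beta_ensemble \<beta> n) B \<le> ennreal (real n * (exp (5/4) * real n * \<epsilon>) powr \<beta>)" .
qed

lemma min_spacing_gt:
  assumes n: "n \<ge> 2"
    and far: "\<And>j k. j \<in> {1..n} \<Longrightarrow> k \<in> {1..n} \<Longrightarrow> j \<noteq> k \<Longrightarrow> \<epsilon> < \<bar>x j - x k\<bar>"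
  shows "\<epsilon> < min_spacing n x"
proof -
  let ?S = "{\<bar>x j - x k\<bar> | j k. j \<in> {1..n} \<and> k \<in> {1..n} \<and> j \<noteq> k}"
  have "?S \<subseteq> (\<lambda>(j, k). \<bar>x j - x k\<bar>) ` ({1..n} \<times> {1..n})" by auto
  then have "finite ?S" by (rule finite_subset) simp
  \<comment> \<open>Nonemptiness makes the minimum attained.\<close>
  moreover have "\<bar>x 1 - x 2\<bar> \<in> ?S" using n by force
  ultimately have "min_spacing n x \<in> ?S"
    unfolding min_spacing_def by (intro Min_in) auto
  then show ?thesis using far by auto
qed

section \<open>The Borel--Cantelli argument\<close>

theorem corollary1p11:
  fixes \<beta> \<tau> :: real
  assumes "\<beta> \<ge> 1" and "\<tau> > 0"
  shows "AE \<omega> in (\<Pi>\<^sub>M n\<in>{1..}. beta_ensemble \<beta> n).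
           liminf (\<lambda>n. ereal (real n powr ((\<beta> + 2 + \<tau>) / \<beta>) * min_spacing n (\<omega> n))) > 0"
proof -
  interpret product_prob_space "beta_ensemble \<beta>" "{1..}"
  proof -
    interpret prob_space "beta_ensemble \<beta> n" for n
      using assms by (intro prob_space_beta_ensemble) simp
    show "product_prob_space (beta_ensemble \<beta>)" ..
  qed
  let ?M = "\<Pi>\<^sub>M n\<in>{1..}. beta_ensemble \<beta> n"
  define p where "p = (\<beta> + 2 + \<tau>) / \<beta>"
  define \<epsilon> where "\<epsilon> = (\<lambda>n. real n powr - p)"
  define B where "B = (\<lambda>n. {x \<in> space (\<Pi>\<^sub>M i\<in>{1..n}. lborel :: real measure).
    \<exists>j\<in>{1..n}. \<exists>k\<in>{1..n} - {j}. \<bar>x j - x k\<bar> \<le> \<epsilon> n})"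
  \<comment> \<open>Below \<open>n = 2\<close> there are no pairs; the empty event is harmless since
    only large \<open>n\<close> matter.\<close>
  define A where "A = (\<lambda>n. if n \<ge> 2 then {\<omega> \<in> space ?M. \<omega> n \<in> B n} else {})"
  have \<epsilon>: "\<epsilon> n > 0" if "n \<ge> 2" for n using that by (simp add: \<epsilon>_def)
  have Bs: "B n \<in> sets (beta_ensemble \<beta> n)"
    and Be: "emeasure (beta_ensemble \<beta> n) (B n) \<le> ennreal (exp (5/4 * \<beta>) * real n powr (- 1 - \<tau>))" if n: "n \<ge> 2" for n
  proof -
    show "B n \<in> sets (beta_ensemble \<beta> n)"
      unfolding B_def by (rule emeasure_close_pair_le(1)[OF assms(1) n \<epsilon>[OF n]])
    \<comment> \<open>The union bound gives the exponent
      \<open>1 + \<beta> - p * \<beta> = - 1 - \<tau>\<close>, which is summable.\<close>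
    have "p * \<beta> = \<beta> + 2 + \<tau>" using assms by (simp add: p_def)
    then have "real n * (exp (5/4) * real n * \<epsilon> n) powr \<beta>
        = exp (5/4 * \<beta>) * (real n powr 1 * real n powr \<beta> * real n powr (- (\<beta> + 2 + \<tau>)))"
      using n by (simp add: \<epsilon>_def powr_mult powr_powr exp_powr_real)
    also have "real n powr 1 * real n powr \<beta> * real n powr (- (\<beta> + 2 + \<tau>)) = real n powr (- 1 - \<tau>)"
      unfolding powr_add[symmetric] by simp
    finally show "emeasure (beta_ensemble \<beta> n) (B n) \<le> ennreal (exp (5/4 * \<beta>) * real n powr (- 1 - \<tau>))"
      using emeasure_close_pair_le(2)[OF assms(1) n \<epsilon>[OF n]] unfolding B_def by simp
  qed
  have As: "A n \<in> sets ?M" for n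
  proof (cases "n \<ge> 2")
    case True
    have "(\<lambda>\<omega>. \<omega> n) \<in> measurable ?M (beta_ensemble \<beta> n)"
      using True by (intro measurable_component_singleton) simp
    from measurable_sets[OF this Bs[OF True]] show ?thesis
      using True by (simp add: A_def vimage_def Int_def conj_commute)
  qed (simp add: A_def)
  have Am: "measure ?M (A n) \<le> exp (5/4 * \<beta>) * real n powr (- 1 - \<tau>)" for n
  proof (cases "n \<ge> 2")
    case True
    \<comment> \<open>\<open>A n\<close> constrains a single component of the sequence, so its
      probability is that of the marginal.\<close>
    have "emeasure ?M (A n) = emeasure (beta_ensemble \<beta> n) (B n)"
      using emeasure_PiM_Collect_single[of n "B n"] True Bs[OF True] by (simp add: A_def)
    then have "emeasure ?M (A n) \<le> ennreal (exp (5/4 * \<beta>) * real n powr (- 1 - \<tau>))"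
      using Be[OF True] by simp
    then show ?thesis by (simp only: P.emeasure_eq_measure ennreal_le_iff mult_nonneg_nonneg exp_ge_zero powr_ge_zero)
  qed (simp add: A_def)
  have "summable (\<lambda>n. real n powr (- 1 - \<tau>))"
    using assms by (subst summable_real_powr_iff) simp
  then have "summable (\<lambda>n. exp (5/4 * \<beta>) * real n powr (- 1 - \<tau>))"
    by (rule summable_mult)
  then have "summable (\<lambda>n. measure ?M (A n))"
    by (rule summable_comparison_test'[where N = 0])
       (simp only: real_norm_def abs_of_nonneg[OF measure_nonneg] Am)
  then have "AE \<omega> in ?M. \<forall>\<^sub>F n in sequentially. \<omega> \<in> space ?M - A n"
    by (intro borel_cantelli_AE1 As) (simp_all only: P.emeasure_eq_measure ennreal_less_top infinity_ennreal_def)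
  then show ?thesis
  proof (rule AE_mp, intro AE_I2 impI)
    fix \<omega> assume \<omega>: "\<omega> \<in> space ?M" and ev: "\<forall>\<^sub>F n in sequentially. \<omega> \<in> space ?M - A n"
    \<comment> \<open>The threshold \<open>\<epsilon> n\<close> is exactly
      \<open>n powr (- p)\<close>, so outside the bad events the normalized spacing is at least 1, a
      bound that survives the \<open>liminf\<close>.\<close>
    have "\<forall>\<^sub>F n in sequentially. 1 \<le> ereal (real n powr p * min_spacing n (\<omega> n))"
      using ev eventually_ge_at_top[of 2]
    proof eventually_elim
      case (elim n)
      have "\<omega> n \<in> space (beta_ensemble \<beta> n)" using \<omega> elim by (auto simp: space_PiM PiE_iff)
      then have "\<omega> n \<in> space (\<Pi>\<^sub>M i\<in>{1..n}. lborel :: real measure)" by (simp add: beta_ensemble_def)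
      moreover have "\<omega> n \<notin> B n" using elim by (simp add: A_def)
      ultimately have "\<epsilon> n < \<bar>\<omega> n j - \<omega> n k\<bar>" if "j \<in> {1..n}" "k \<in> {1..n}" "j \<noteq> k" for j k
        using that unfolding B_def by force
      then have "\<epsilon> n < min_spacing n (\<omega> n)" using elim by (intro min_spacing_gt) auto
      then have "real n powr p * \<epsilon> n \<le> real n powr p * min_spacing n (\<omega> n)"
        by (intro mult_left_mono) auto
      moreover have "real n powr p * \<epsilon> n = 1" using elim by (simp add: \<epsilon>_def powr_minus)
      ultimately show ?case by simp
    qed
    then have "1 \<le> liminf (\<lambda>n. ereal (real n powr p * min_spacing n (\<omega> n)))"
      by (rule Liminf_bounded)
    then show "liminf (\<lambda>n. ereal (real n powr ((\<beta> + 2 + \<tau>) / \<beta>) * min_spacing n (\<omega> n))) > 0"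
      unfolding p_def[symmetric] by (rule less_le_trans[rotated]) simp
  qed
qed

end
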